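(* Let $(X,\mathcal X)$ be a measurable space with a finite measure $\lambda$ without atoms. For each $n\in\mathbb N$ let $C_n^1,\dots,C_n^{K_n}\in\mathcal X$ be pairwise disjoint with $\bigcup_{k=1}^{K_n}C_n^k=X$, where the number of sets $K_n$ is monotonically nondecreasing in $n$ (but may stay bounded). Let $q_n>0$ and $r_n>0$ be monotone sequences with $q_n\to\infty$ and $r_n\to r\in[0,\infty)$ such that $\sqrt{K_n/q_n}\in o(r_n)$. For each $n$ let $\boldsymbol E_{q_n}$ be a Poisson point process on $(X,\mathcal X)$ with (finite) intensity measure $q_n\lambda$. Assume that one of the following two conditions holds: (a) $(\boldsymbol E_{q_n})_n$ is an arbitrary sequence of Poisson point processes with intensity measures $q_n\lambda$ (with arbitrary joint law), and $\sqrt{\log(n)/q_n}\in o(r_n)$; (b) $(\boldsymbol E_{q_n})_n$ is defined via stochastic coupling, $\sqrt{\log\log(q_n)/q_n}\in o(r_n)$, and the partitions are nested, i.e. for every $k\in\{1,\dots,K_n\}$ there exists $k'\in\{1,\dots,K_{n-1}\}$ with $C_n^k\subset C_{n-1}^{k'}$. Then $$\frac1{r_n}\sum_{k=1}^{K_n}\left|\frac1{q_n}\boldsymbol E_{q_n}(C_n^k)-\lambda(C_n^k)\right|\longrightarrow 0\quad\text{almost surely as }n\to\infty .$$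
   Context: All random variables live on a probability space $(\Omega,\mathcal F,\mathbb P)$. A Poisson point process with intensity measure $\mu$ on $(X,\mathcal X)$ is a point process $\boldsymbol N$ on $X$ such that $\boldsymbol N(B)$ is Poisson distributed with parameter $\mu(B)$ for every $B\in\mathcal X$, and $\boldsymbol N(B_1),\dots,\boldsymbol N(B_m)$ are independent for any pairwise disjoint $B_1,\dots,B_m\in\mathcal X$. Stochastic coupling: let $\boldsymbol Y$ be a Poisson point process on $X\times[0,\infty)$ with intensity measure $\lambda\otimes\mathcal L$ ($\mathcal L$ the one-dimensional Lebesgue measure). The sequence $(\boldsymbol E_{q_n})_n$ is said to be defined via stochastic coupling if $\boldsymbol E_{q_n}(\omega)(C)=\boldsymbol Y(\omega)(C\times[0,q_n])$ for all $\omega\in\Omega$, $C\in\mathcal X$ and all $n$, with one and the same $\boldsymbol Y$. (Each $\boldsymbol E_{q_n}$ is then a Poisson point process with intensity measure $q_n\lambda$.) $f_n\in o(g_n)$ means $\lim_n f_n/g_n=0$. *)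

theory Defs
  imports "HOL-Probability.Probability" "HOL-Library.Landau_Symbols"
begin

definition is_atom :: "'a measure \<Rightarrow> 'a set \<Rightarrow> bool" where
  "is_atom \<mu> A \<longleftrightarrow> A \<in> sets \<mu> \<and> emeasure \<mu> A > 0 \<and>
     (\<forall>B\<in>sets \<mu>. B \<subseteq> A \<longrightarrow> emeasure \<mu> B = 0 \<or> emeasure \<mu> B = emeasure \<mu> A)"

text \<open>The law of an extended-nonnegative random variable: Poisson with parameter
  \<open>c\<close>, where \<open>c = \<infinity>\<close> means the point mass at \<open>\<infinity>\<close> (needed for intensity measures that are
  not finite).  The mass function is written out because the library's \<open>poisson_pmf\<close> is
  specified only for strictly positive rates; here \<open>c = 0\<close> gives the point mass at \<open>0\<close>.\<close>

definition poisson_distributed :: "'w measure \<Rightarrow> ('w \<Rightarrow> ennreal) \<Rightarrow> ennreal \<Rightarrow> bool" where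
  "poisson_distributed P Z c \<longleftrightarrow>
     (if c = \<infinity> then AE \<omega> in P. Z \<omega> = \<infinity>
      else \<forall>k::nat. measure P {\<omega> \<in> space P. Z \<omega> = of_nat k}
                   = enn2real c ^ k / fact k * exp (- enn2real c))"

text \<open>A point process on the measurable space underlying \<open>X\<close> (only \<open>space X\<close> and
  \<open>sets X\<close> matter) is a random measure with values in \<open>{0, 1, 2, \<dots>, \<infinity>}\<close>.\<close>

definition point_process :: "'w measure \<Rightarrow> 'a measure \<Rightarrow> ('w \<Rightarrow> 'a measure) \<Rightarrow> bool" where
  "point_process P X N \<longleftrightarrow>
     (\<forall>\<omega>\<in>space P. sets (N \<omega>) = sets X \<and>
        (\<forall>B\<in>sets X. emeasure (N \<omega>) B \<in> range of_nat \<union> {\<infinity>})) \<and>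
     (\<forall>B\<in>sets X. (\<lambda>\<omega>. emeasure (N \<omega>) B) \<in> borel_measurable P)"

definition poisson_point_process ::
    "'w measure \<Rightarrow> 'a measure \<Rightarrow> ('w \<Rightarrow> 'a measure) \<Rightarrow> bool" where
  "poisson_point_process P \<mu> N \<longleftrightarrow>
     point_process P \<mu> N \<and>
     (\<forall>B\<in>sets \<mu>. poisson_distributed P (\<lambda>\<omega>. emeasure (N \<omega>) B) (emeasure \<mu> B)) \<and>
     (\<forall>(m::nat) B. (\<forall>i<m. B i \<in> sets \<mu>) \<and> disjoint_family_on B {..<m} \<longrightarrow>
        prob_space.indep_vars P (\<lambda>_. borel) (\<lambda>i \<omega>. emeasure (N \<omega>) (B i)) {..<m})"

definition stochastic_coupling ::
    "'w measure \<Rightarrow> 'a measure \<Rightarrow> (nat \<Rightarrow> real) \<Rightarrow> (nat \<Rightarrow> 'w \<Rightarrow> 'a measure) \<Rightarrow> bool" where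
  "stochastic_coupling P \<mu> q E \<longleftrightarrow>
     (\<exists>Y. poisson_point_process P (\<mu> \<Otimes>\<^sub>M restrict_space lborel {0..}) Y \<and>
        (\<forall>n. \<forall>\<omega>\<in>space P. \<forall>C\<in>sets \<mu>.
           emeasure (E n \<omega>) C = emeasure (Y \<omega>) (C \<times> {0..q n})))"

end

theory Submission
  imports Defs
begin

text \<open>The proof rests on one exponential estimate.  For a Poisson variable \<open>Z\<close> with mean \<open>m\<close> and \<open>0 \<le> t \<le> 1\<close>, the
exponential moment of \<open>t * \<bar>Z - m\<bar>\<close> is at most \<open>2 * exp (m * t\<^sup>2)\<close>.  The counts of the \<open>K\<close> cells of a
partition are independent, so these bounds multiply, and Markov's inequality shows that the total absolute
deviation \<open>\<Sum>\<^sub>k \<bar>E (C k) - q * \<mu> (C k)\<bar>\<close> exceeds \<open>a\<close> with probability at most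
\<open>2 ^ K * exp (q * \<mu> X * t\<^sup>2 - t * a)\<close> (\<open>poisson_L1_deviation\<close>).  With \<open>a = \<epsilon> * q * r\<close> and \<open>t\<close> a small multiple
of \<open>r\<close>, the exponent is a negative multiple of \<open>q * r\<^sup>2\<close>.  By the growth hypotheses \<open>q * r\<^sup>2\<close> dominates both
\<open>K\<close>, which pays for the factor \<open>2 ^ K\<close>, and the logarithmic term \<open>L\<close>, so that the probability is eventually at
most \<open>exp (- 2 * L)\<close> (\<open>eventually_chernoff_bound\<close>).

For an arbitrary joint law \<open>L = ln n\<close>, the bound is \<open>1 / n\<^sup>2\<close>, and the Borel-Cantelli lemma applies directly.

Under the stochastic coupling only \<open>L = ln (ln q)\<close> is available, which is too weak for a union over all \<open>n\<close>.  As in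
the law of the iterated logarithm, the indices are grouped into dyadic blocks \<open>2 ^ j \<le> q n < 2 ^ Suc j\<close>.
Refining a partition only increases the total absolute deviation (\<open>refinement_increases_L1\<close>), so throughout a block
the deviation may be measured on the finest partition of the block, that of its last index \<open>N\<close>.  On this fixed
partition the counts evolve in the intensity with independent increments, so Ottaviani's inequality controls the
maximum over the block by the deviation at its end (\<open>coupling_maximal_inequality\<close>).  A block then fails with
probability at most \<open>2 / (ln (q N))\<^sup>2 \<le> 2 / (j * ln 2)\<^sup>2\<close>, which is summable over \<open>j\<close>.\<close>

section \<open>Exponential deviation bounds for Poisson counts\<close>

lemma exp_remainder_le_square:
  fixes t :: real
  assumes "0 \<le> t" "t \<le> 1"
  shows "exp t - 1 - t \<le> t\<^sup>2" and "exp (- t) - 1 + t \<le> t\<^sup>2"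
proof -
  show "exp t - 1 - t \<le> t\<^sup>2"
    using exp_bound[OF assms] by simp
  have "1 \<le> 1 + t * t\<^sup>2"
    using assms by simp
  also have "\<dots> = (1 - t + t\<^sup>2) * (1 + t)"
    by (simp add: algebra_simps power2_eq_square)
  also have "\<dots> \<le> (1 - t + t\<^sup>2) * exp t"
  proof (rule mult_left_mono)
    show "0 \<le> 1 - t + t\<^sup>2" using assms by (simp add: add_nonneg_nonneg)
  qed (rule exp_ge_add_one_self)
  finally have "exp (- t) \<le> 1 - t + t\<^sup>2"
    by (simp add: exp_minus field_simps)
  then show "exp (- t) - 1 + t \<le> t\<^sup>2" by simp
qed

text \<open>The weights of the Poisson distribution already sum to one over the natural numbers, so no mass is left for any
other value, in particular for \<open>\<infinity>\<close>.\<close>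

lemma poisson_distributed_AE_nat:
  assumes "prob_space P" and [measurable]: "Z \<in> borel_measurable P"
    and Z: "poisson_distributed P Z (ennreal m)" and m: "0 \<le> m"
  shows "AE \<omega> in P. Z \<omega> \<in> range of_nat"
proof -
  interpret prob_space P by fact
  let ?A = "\<lambda>k::nat. {\<omega> \<in> space P. Z \<omega> = of_nat k}"
  have [measurable]: "?A k \<in> sets P" for k by measurable
  have "(\<lambda>k. m ^ k /\<^sub>R fact k * exp (- m)) sums (exp m * exp (- m))"
    by (intro sums_mult2 exp_converges)
  moreover have "measure P (?A k) = m ^ k /\<^sub>R fact k * exp (- m)" for k
    using Z m by (simp add: poisson_distributed_def scaleR_conv_of_real field_simps)
  ultimately have "(\<lambda>k. measure P (?A k)) sums 1"
    by (simp add: exp_minus)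
  moreover have "(\<lambda>k. measure P (?A k)) sums measure P (\<Union>k. ?A k)"
    by (rule finite_measure_UNION) (auto simp: disjoint_family_on_def)
  ultimately have "measure P (\<Union>k. ?A k) = 1"
    by (rule sums_unique2[symmetric])
  then have "AE \<omega> in P. \<omega> \<in> (\<Union>k. ?A k)"
    by (subst prob_eq_1[symmetric]) auto
  then show ?thesis by eventually_elim auto
qed

lemma poisson_exponential_moment:
  assumes "prob_space P" and [measurable]: "Z \<in> borel_measurable P"
    and Z: "poisson_distributed P Z (ennreal m)" and m: "0 \<le> m"
  shows "(\<integral>\<^sup>+\<omega>. ennreal (exp (s * (enn2real (Z \<omega>) - m))) \<partial>P) = ennreal (exp (m * (exp s - 1 - s)))"
proof -
  interpret prob_space P by fact
  let ?A = "\<lambda>k::nat. {\<omega> \<in> space P. Z \<omega> = of_nat k}"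
  have [measurable]: "?A k \<in> sets P" for k by measurable
  let ?g = "\<lambda>k::nat. exp (s * (real k - m))"
  have pmf: "measure P (?A k) = m ^ k / fact k * exp (- m)" for k
    using Z m by (simp add: poisson_distributed_def)
  have "(\<integral>\<^sup>+\<omega>. ennreal (exp (s * (enn2real (Z \<omega>) - m))) \<partial>P)
      = (\<integral>\<^sup>+\<omega>. (\<Sum>k. ennreal (?g k) * indicator (?A k) \<omega>) \<partial>P)"
  proof (rule nn_integral_cong_AE)
    show "AE \<omega> in P. ennreal (exp (s * (enn2real (Z \<omega>) - m)))
        = (\<Sum>k. ennreal (?g k) * indicator (?A k) \<omega>)"
      using poisson_distributed_AE_nat[OF assms] AE_space
    proof eventually_elim
      fix \<omega> assume "Z \<omega> \<in> range of_nat" and \<omega>: "\<omega> \<in> space P"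
      then obtain n where n: "Z \<omega> = of_nat n" by auto
      have "(\<Sum>k. ennreal (?g k) * indicator (?A k) \<omega>)
          = (\<Sum>k\<in>{n}. ennreal (?g k) * indicator (?A k) \<omega>)"
        by (rule suminf_finite) (auto simp: n indicator_def)
      then show "ennreal (exp (s * (enn2real (Z \<omega>) - m)))
        = (\<Sum>k. ennreal (?g k) * indicator (?A k) \<omega>)"
        using \<omega> by (simp add: n)
    qed
  qed
  also have "\<dots> = (\<Sum>k. \<integral>\<^sup>+\<omega>. ennreal (?g k) * indicator (?A k) \<omega> \<partial>P)"
    by (rule nn_integral_suminf) measurable
  also have "\<dots> = (\<Sum>k. ennreal (?g k * measure P (?A k)))"
    by (simp add: nn_integral_cmult emeasure_eq_measure ennreal_mult)
  also have "(\<lambda>k. ?g k * measure P (?A k)) = (\<lambda>k. (m * exp s) ^ k /\<^sub>R fact k * exp (- m - s * m))"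
    by (rule ext) (simp add: pmf power_mult_distrib exp_of_nat_mult[symmetric] exp_diff exp_minus
        field_simps scaleR_conv_of_real exp_add)
  also have "(\<Sum>k. ennreal ((m * exp s) ^ k /\<^sub>R fact k * exp (- m - s * m)))
      = ennreal (exp (m * exp s) * exp (- m - s * m))"
    using m by (intro suminf_ennreal_eq sums_mult2 exp_converges) auto
  also have "exp (m * exp s) * exp (- m - s * m) = exp (m * (exp s - 1 - s))"
    by (simp add: exp_add[symmetric] algebra_simps)
  finally show ?thesis .
qed

text \<open>The absolute value is handled by \<open>exp \<bar>x\<bar> \<le> exp x + exp (- x)\<close>, the source of the factor \<open>2\<close>; centring
makes the exponents of both terms quadratic in \<open>t\<close>.\<close>

lemma poisson_absolute_exponential_moment:
  assumes "prob_space P" and [measurable]: "Z \<in> borel_measurable P"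
    and Z: "poisson_distributed P Z (ennreal m)" and m: "0 \<le> m" and t: "0 \<le> t" "t \<le> 1"
  shows "(\<integral>\<^sup>+\<omega>. ennreal (exp (t * \<bar>enn2real (Z \<omega>) - m\<bar>)) \<partial>P) \<le> ennreal (2 * exp (m * t\<^sup>2))"
proof -
  have "(\<integral>\<^sup>+\<omega>. ennreal (exp (t * \<bar>enn2real (Z \<omega>) - m\<bar>)) \<partial>P)
    \<le> (\<integral>\<^sup>+\<omega>. ennreal (exp (t * (enn2real (Z \<omega>) - m)))
        + ennreal (exp ((- t) * (enn2real (Z \<omega>) - m))) \<partial>P)"
    by (intro nn_integral_mono) (auto simp: abs_if ennreal_plus[symmetric] algebra_simps
        simp del: ennreal_plus)
  also have "\<dots> = ennreal (exp (m * (exp t - 1 - t))) + ennreal (exp (m * (exp (- t) - 1 - (- t))))"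
    by (subst nn_integral_add) (simp_all only: poisson_exponential_moment[OF assms(1-4)], measurable)
  also have "\<dots> \<le> ennreal (exp (m * t\<^sup>2)) + ennreal (exp (m * t\<^sup>2))"
    using exp_remainder_le_square[OF t] m
    by (intro add_mono ennreal_leI) (auto intro!: mult_left_mono)
  also have "\<dots> = ennreal (2 * exp (m * t\<^sup>2))"
    by (simp add: ennreal_plus[symmetric] del: ennreal_plus)
  finally show ?thesis .
qed

text \<open>A Chernoff bound: independence turns the exponential moment of the sum into a product of single-cell moments.
Only an upper bound \<open>M\<close> for the total mean enters, so one bound serves processes observed over windows of
different lengths.\<close>

lemma poisson_L1_deviation:
  assumes "prob_space P" and I: "finite I"
    and indep: "prob_space.indep_vars P (\<lambda>_. borel) W I"
    and W: "\<And>i. i \<in> I \<Longrightarrow> poisson_distributed P (W i) (ennreal (m i))"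
    and m: "\<And>i. i \<in> I \<Longrightarrow> 0 \<le> m i" and M: "(\<Sum>i\<in>I. m i) \<le> M"
    and t: "0 \<le> t" "t \<le> 1"
  shows "measure P {\<omega> \<in> space P. a \<le> (\<Sum>i\<in>I. \<bar>enn2real (W i \<omega>) - m i\<bar>)}
    \<le> 2 ^ card I * exp (M * t\<^sup>2 - t * a)"
proof -
  interpret prob_space P by fact
  have [measurable]: "W i \<in> borel_measurable P" if "i \<in> I" for i
    using indep that by (auto simp: indep_vars_def)
  let ?S = "\<lambda>\<omega>. \<Sum>i\<in>I. \<bar>enn2real (W i \<omega>) - m i\<bar>"
  let ?f = "\<lambda>i \<omega>. ennreal (exp (t * \<bar>enn2real (W i \<omega>) - m i\<bar>))"
  have prod_exp: "(\<Prod>i\<in>I. ?f i \<omega>) = ennreal (exp (t * ?S \<omega>))" for \<omega>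
    by (simp add: prod_ennreal exp_sum[OF I] sum_distrib_left)
  have "(\<integral>\<^sup>+\<omega>. (\<Prod>i\<in>I. ?f i \<omega>) \<partial>P) = (\<Prod>i\<in>I. \<integral>\<^sup>+\<omega>. ?f i \<omega> \<partial>P)"
    by (intro indep_vars_nn_integral I indep_vars_compose2[OF indep]) auto
  also have "\<dots> \<le> (\<Prod>i\<in>I. ennreal (2 * exp (m i * t\<^sup>2)))"
    using W m t by (intro prod_mono_ennreal poisson_absolute_exponential_moment) 
      (auto intro: prob_space_axioms)
  also have "\<dots> = ennreal (2 ^ card I * exp ((\<Sum>i\<in>I. m i) * t\<^sup>2))"
    by (simp add: prod_ennreal prod.distrib exp_sum[OF I] sum_distrib_right)
  also have "\<dots> \<le> ennreal (2 ^ card I * exp (M * t\<^sup>2))"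
    using M by (intro ennreal_leI mult_left_mono) (auto intro!: mult_right_mono)
  finally have moment: "(\<integral>\<^sup>+\<omega>. ennreal (exp (t * ?S \<omega>)) \<partial>P) \<le> ennreal (2 ^ card I * exp (M * t\<^sup>2))"
    by (simp add: prod_exp)
  have "emeasure P {\<omega> \<in> space P. a \<le> ?S \<omega>}
    \<le> (\<integral>\<^sup>+\<omega>. ennreal (exp (- (t * a))) * ennreal (exp (t * ?S \<omega>)) \<partial>P)"
  proof (subst nn_integral_indicator[symmetric])
    show "(\<integral>\<^sup>+ \<omega>. indicator {\<omega> \<in> space P. a \<le> ?S \<omega>} \<omega> \<partial>P)
      \<le> (\<integral>\<^sup>+\<omega>. ennreal (exp (- (t * a))) * ennreal (exp (t * ?S \<omega>)) \<partial>P)"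
    proof (rule nn_integral_mono)
      fix \<omega>
      show "indicator {\<omega> \<in> space P. a \<le> ?S \<omega>} \<omega> \<le> ennreal (exp (- (t * a))) * ennreal (exp (t * ?S \<omega>))"
        using mult_left_mono[OF _ t(1), of a "?S \<omega>"]
        by (auto simp: indicator_def ennreal_mult[symmetric] exp_add[symmetric])
    qed
  qed measurable
  also have "\<dots> = ennreal (exp (- (t * a))) * (\<integral>\<^sup>+\<omega>. ennreal (exp (t * ?S \<omega>)) \<partial>P)"
    by (rule nn_integral_cmult) measurable
  also have "\<dots> \<le> ennreal (exp (- (t * a))) * ennreal (2 ^ card I * exp (M * t\<^sup>2))"
    by (intro mult_left_mono moment) auto
  also have "\<dots> = ennreal (2 ^ card I * exp (M * t\<^sup>2 - t * a))"
    by (simp add: ennreal_mult[symmetric] exp_diff exp_minus field_simps)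
  finally show ?thesis
    by (simp add: emeasure_eq_measure)
qed

section \<open>Counts of a Poisson point process\<close>

lemma scaled_poisson_process_count:
  assumes "finite_measure \<mu>" and N: "poisson_point_process P (scale_measure (ennreal c) \<mu>) N" and c: "0 \<le> c"
    and B: "B \<in> sets \<mu>"
  shows "(\<lambda>\<omega>. emeasure (N \<omega>) B) \<in> borel_measurable P"
    and "poisson_distributed P (\<lambda>\<omega>. emeasure (N \<omega>) B) (ennreal (c * measure \<mu> B))"
proof -
  have "emeasure (scale_measure (ennreal c) \<mu>) B = ennreal (c * measure \<mu> B)"
    using c by (simp add: finite_measure.emeasure_eq_measure[OF \<open>finite_measure \<mu>\<close>] ennreal_mult)
  moreover have "B \<in> sets (scale_measure (ennreal c) \<mu>)" using B by simp
  ultimately show "(\<lambda>\<omega>. emeasure (N \<omega>) B) \<in> borel_measurable P"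
    and "poisson_distributed P (\<lambda>\<omega>. emeasure (N \<omega>) B) (ennreal (c * measure \<mu> B))"
    using N unfolding poisson_point_process_def point_process_def by metis+
qed

text \<open>The definition gives independence for sets numbered by an initial segment of the naturals.  The increments of a
coupled family are indexed by pairs of a time window and a cell, so the numbering is removed here.\<close>

lemma poisson_point_process_indep:
  assumes "prob_space P" and N: "poisson_point_process P \<nu> N" and J: "finite J"
    and B: "\<And>j. j \<in> J \<Longrightarrow> B j \<in> sets \<nu>" and disj: "disjoint_family_on B J"
  shows "prob_space.indep_vars P (\<lambda>_. borel) (\<lambda>j \<omega>. emeasure (N \<omega>) (B j)) J"
proof -
  interpret prob_space P by fact
  obtain h where h: "bij_betw h {..<card J} J"
    using ex_bij_betw_nat_finite[OF J] by (auto simp: atLeast0LessThan)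
  define g where "g = the_inv_into {..<card J} h"
  have g: "bij_betw g J {..<card J}"
    unfolding g_def by (rule bij_betw_the_inv_into[OF h])
  have hg: "h (g j) = j" if "j \<in> J" for j
    using h that unfolding g_def by (simp add: f_the_inv_into_f_bij_betw)
  have hJ: "h i \<in> J" if "i < card J" for i
    using h that by (auto simp: bij_betw_def)
  have "disjoint_family_on (\<lambda>i. B (h i)) {..<card J}"
    unfolding disjoint_family_on_def
  proof (intro ballI impI)
    fix i j assume ij: "i \<in> {..<card J}" "j \<in> {..<card J}" "i \<noteq> j"
    then have "h i \<noteq> h j" using h by (auto simp: bij_betw_def inj_on_def)
    then show "B (h i) \<inter> B (h j) = {}"
      using ij hJ disj by (auto simp: disjoint_family_on_def)
  qed
  moreover have "\<forall>i<card J. B (h i) \<in> sets \<nu>" using B hJ by blast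
  ultimately have "indep_vars (\<lambda>_. borel) (\<lambda>i \<omega>. emeasure (N \<omega>) (B (h i))) {..<card J}"
    using N[unfolded poisson_point_process_def, THEN conjunct2, THEN conjunct2, rule_format,
        of "card J" "\<lambda>i. B (h i)"] by blast
  \<comment> \<open>Independence of the enumerated family is transported back to \<open>J\<close>
    by viewing each variable as a one-element block of it.\<close>
  then have "indep_vars (\<lambda>j. PiM {g j} (\<lambda>_. borel))
      (\<lambda>j \<omega>. restrict (\<lambda>i. emeasure (N \<omega>) (B (h i))) {g j}) J"
    using g by (rule_tac indep_vars_restrict)
      (auto simp: bij_betw_def disjoint_family_on_def inj_on_def)
  then have "indep_vars (\<lambda>_. borel)
      (\<lambda>j \<omega>. restrict (\<lambda>i. emeasure (N \<omega>) (B (h i))) {g j} (g j)) J"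
    by (rule indep_vars_compose2) (auto intro: measurable_component_singleton)
  then show ?thesis
    by (subst indep_vars_cong[where J=J and N'="\<lambda>_. borel" and
          Y="\<lambda>j \<omega>. restrict (\<lambda>i. emeasure (N \<omega>) (B (h i))) {g j} (g j)"])
      (auto simp: hg)
qed

section \<open>A maximal inequality for sums of independent increments\<close>

text \<open>Ottaviani's inequality for vectors indexed by \<open>k\<close> with the \<open>\<ell>\<^sup>1\<close> norm.  When the partial sums first reach
\<open>2 * a\<close> at time \<open>i\<close>, the total sum stays above \<open>a\<close> unless the later increments add up to \<open>a\<close> or more.
The latter is independent of what happened up to time \<open>i\<close> and has probability at most one half, so at least half of
the probability that the partial sums ever reach \<open>2 * a\<close> survives in the event that the total sum reaches \<open>a\<close>.\<close>

lemma ottaviani_L1: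
  fixes X :: "nat \<Rightarrow> 'k \<Rightarrow> 'w \<Rightarrow> real"
  assumes "prob_space P" and I: "finite I"
    and indep: "prob_space.indep_vars P (\<lambda>_. borel) (\<lambda>(l, k). X l k) ({..<m} \<times> I)"
    and tail: "\<And>i. i < m \<Longrightarrow>
      measure P {\<omega> \<in> space P. a \<le> (\<Sum>k\<in>I. \<bar>\<Sum>l\<in>{i<..<m}. X l k \<omega>\<bar>)} \<le> 1 / 2"
  shows "measure P {\<omega> \<in> space P. \<exists>i<m. 2 * a \<le> (\<Sum>k\<in>I. \<bar>\<Sum>l\<le>i. X l k \<omega>\<bar>)}
    \<le> 2 * measure P {\<omega> \<in> space P. a \<le> (\<Sum>k\<in>I. \<bar>\<Sum>l<m. X l k \<omega>\<bar>)}"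
proof -
  interpret prob_space P by fact
  have [measurable]: "X l k \<in> borel_measurable P" if "l < m" "k \<in> I" for l k
    using indep that by (auto simp: indep_vars_def)
  define S where "S i \<omega> = (\<Sum>k\<in>I. \<bar>\<Sum>l\<le>i. X l k \<omega>\<bar>)" for i \<omega>
  define R where "R i \<omega> = (\<Sum>k\<in>I. \<bar>\<Sum>l\<in>{i<..<m}. X l k \<omega>\<bar>)" for i \<omega>
  define T where "T \<omega> = (\<Sum>k\<in>I. \<bar>\<Sum>l<m. X l k \<omega>\<bar>)" for \<omega>
  have [measurable]: "S i \<in> borel_measurable P" if "i < m" for i
    unfolding S_def using that by (intro borel_measurable_sum borel_measurable_abs) auto
  have [measurable]: "R i \<in> borel_measurable P" for i
    unfolding R_def by (intro borel_measurable_sum borel_measurable_abs) auto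
  have [measurable]: "T \<in> borel_measurable P"
    unfolding T_def by (intro borel_measurable_sum borel_measurable_abs) auto
  \<comment> \<open>\<open>A i\<close>: the partial sums first reach \<open>2 * a\<close> at time \<open>i\<close>;
    \<open>B i\<close>: the increments after time \<open>i\<close> add up to less than \<open>a\<close>.\<close>
  define A where "A i = {\<omega> \<in> space P. 2 * a \<le> S i \<omega> \<and> (\<forall>j<i. S j \<omega> < 2 * a)}" for i
  define B where "B i = {\<omega> \<in> space P. R i \<omega> < a}" for i
  have A[measurable]: "A i \<in> sets P" if "i < m" for i
  proof -
    have "(\<lambda>\<omega>. S j \<omega>) \<in> borel_measurable P" if "j \<in> {..<i}" for j
      using that \<open>i < m\<close> by auto
    moreover have "S i \<in> borel_measurable P" using that by simp
    moreover have "A i = {\<omega> \<in> space P. 2 * a \<le> S i \<omega> \<and> (\<forall>j\<in>{..<i}. S j \<omega> < 2 * a)}"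
      by (auto simp: A_def)
    ultimately show ?thesis by simp
  qed
  have B[measurable]: "B i \<in> sets P" for i
    unfolding B_def by measurable
  have disjA: "disjoint_family_on A {..<m}"
    unfolding disjoint_family_on_def A_def by (auto simp: not_le[symmetric]) (metis linorder_neqE_nat not_le)
  \<comment> \<open>\<open>A i\<close> and \<open>B i\<close> depend on disjoint blocks of the independent family.\<close>
  have AB: "measure P (A i \<inter> B i) = measure P (A i) * measure P (B i)" if i: "i < m" for i
  proof -
    let ?P = "{..i} \<times> I" and ?F = "{i<..<m} \<times> I"
    let ?X = "\<lambda>J \<omega>. restrict (\<lambda>p. (case p of (l, k) \<Rightarrow> X l k) \<omega>) J"
    define s where "s j x = (\<Sum>k\<in>I. \<bar>\<Sum>l\<le>j. x (l, k) :: real\<bar>)" for j :: nat and x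
    define \<rho> where "\<rho> x = (\<Sum>k\<in>I. \<bar>\<Sum>l\<in>{i<..<m}. x (l, k) :: real\<bar>)" for x
    have [measurable]: "s j \<in> borel_measurable (PiM ?P (\<lambda>_. borel))" if "j \<le> i" for j
      unfolding s_def using that
      by (intro borel_measurable_sum borel_measurable_abs measurable_component_singleton) auto
    have [measurable]: "\<rho> \<in> borel_measurable (PiM ?F (\<lambda>_. borel))"
      unfolding \<rho>_def
      by (intro borel_measurable_sum borel_measurable_abs measurable_component_singleton) auto
    define A' where "A' = {x \<in> space (PiM ?P (\<lambda>_. borel)). 2 * a \<le> s i x \<and> (\<forall>j\<in>{..<i}. s j x < 2 * a)}"
    define B' where "B' = {x \<in> space (PiM ?F (\<lambda>_. borel)). \<rho> x < a}"
    have ind: "indep_var (PiM ?P (\<lambda>_. borel)) (?X ?P) (PiM ?F (\<lambda>_. borel)) (?X ?F)"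
      using i by (intro indep_var_restrict[OF indep]) auto
    have A': "A' \<in> sets (PiM ?P (\<lambda>_. borel))"
      unfolding A'_def by measurable
    have B': "B' \<in> sets (PiM ?F (\<lambda>_. borel))"
      unfolding B'_def by measurable
    have s_eq: "s j (?X ?P \<omega>) = S j \<omega>" if "j \<le> i" for j \<omega>
      unfolding s_def S_def using that by (intro sum.cong arg_cong[where f=abs]) auto
    have \<rho>_eq: "\<rho> (?X ?F \<omega>) = R i \<omega>" for \<omega>
      unfolding \<rho>_def R_def by (intro sum.cong arg_cong[where f=abs]) auto
    have a: "?X ?P -` A' \<inter> space P = A i"
      by (auto simp: A'_def A_def s_eq space_PiM)
    have b: "?X ?F -` B' \<inter> space P = B i"
      by (auto simp: B'_def B_def \<rho>_eq space_PiM)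
    have "(\<lambda>\<omega>. (?X ?P \<omega>, ?X ?F \<omega>)) -` (A' \<times> B') \<inter> space P = A i \<inter> B i"
      using a b by blast
    then show ?thesis
      using indep_varD[OF ind A' B'] by (simp only: a b)
  qed
  have half: "1 / 2 \<le> measure P (B i)" if "i < m" for i
  proof -
    have "space P - B i = {\<omega> \<in> space P. a \<le> R i \<omega>}" by (auto simp: B_def)
    then have "measure P (space P - B i) \<le> 1 / 2"
      using tail[OF that] by (simp add: R_def)
    then show ?thesis by (simp add: prob_compl[OF B])
  qed
  have T_large: "a \<le> T \<omega>" if i: "i < m" and "\<omega> \<in> A i" "\<omega> \<in> B i" for i \<omega>
  proof -
    have "2 * a \<le> S i \<omega>" "R i \<omega> < a" using that by (auto simp: A_def B_def)
    moreover have "S i \<omega> \<le> T \<omega> + R i \<omega>"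
      unfolding S_def T_def R_def sum.distrib[symmetric]
    proof (rule sum_mono)
      fix k
      have "{..<m} = {..i} \<union> {i<..<m}" using i by auto
      then have "(\<Sum>l<m. X l k \<omega>) = (\<Sum>l\<le>i. X l k \<omega>) + (\<Sum>l\<in>{i<..<m}. X l k \<omega>)"
        by (simp add: sum.union_disjoint ivl_disj_int)
      then show "\<bar>\<Sum>l\<le>i. X l k \<omega>\<bar> \<le> \<bar>\<Sum>l<m. X l k \<omega>\<bar> + \<bar>\<Sum>l\<in>{i<..<m}. X l k \<omega>\<bar>"
        by linarith
    qed
    ultimately show ?thesis by linarith
  qed
  have "{\<omega> \<in> space P. \<exists>i<m. 2 * a \<le> S i \<omega>} = (\<Union>i<m. A i)"
  proof (intro equalityI subsetI)
    fix \<omega> assume "\<omega> \<in> {\<omega> \<in> space P. \<exists>i<m. 2 * a \<le> S i \<omega>}"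
    then obtain i where \<omega>: "\<omega> \<in> space P" and i: "i < m" "2 * a \<le> S i \<omega>" by auto
    define j where "j = (LEAST i. 2 * a \<le> S i \<omega>)"
    have "2 * a \<le> S j \<omega>" unfolding j_def by (rule LeastI, rule i(2))
    moreover have "j \<le> i" unfolding j_def by (rule Least_le, rule i(2))
    moreover have "\<forall>l<j. S l \<omega> < 2 * a" unfolding j_def using not_less_Least by force
    ultimately show "\<omega> \<in> (\<Union>i<m. A i)" using \<omega> i by (auto simp: A_def)
  qed (auto simp: A_def)
  then have "measure P {\<omega> \<in> space P. \<exists>i<m. 2 * a \<le> S i \<omega>} = (\<Sum>i<m. measure P (A i))"
    using finite_measure_finite_Union[OF _ _ disjA] A by (simp add: image_subset_iff)
  also have "\<dots> \<le> (\<Sum>i<m. 2 * measure P (A i \<inter> B i))"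
  proof (rule sum_mono)
    fix i assume "i \<in> {..<m}"
    then have i: "i < m" by simp
    have "measure P (A i) * (1 / 2) \<le> measure P (A i) * measure P (B i)"
      by (intro mult_left_mono half i) simp
    then show "measure P (A i) \<le> 2 * measure P (A i \<inter> B i)"
      unfolding AB[OF i] by linarith
  qed
  also have "\<dots> = 2 * measure P (\<Union>i<m. A i \<inter> B i)"
    using disjA A by (subst finite_measure_finite_Union)
      (auto simp: disjoint_family_on_def sum_distrib_left)
  also have "\<dots> \<le> 2 * measure P {\<omega> \<in> space P. a \<le> T \<omega>}"
    using T_large by (intro mult_left_mono finite_measure_mono) (auto simp: A_def)
  finally show ?thesis unfolding S_def T_def .
qed
text \<open>Under the coupling, the counts on fixed disjoint sets at the times \<open>q 0 \<le> \<dots> \<le> q N\<close> are partial sums of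
the counts of the driving process on products with disjoint time windows, hence have independent increments, and
Ottaviani's inequality applies.  Each sum of increments over consecutive windows is itself a centred Poisson count
with mean at most \<open>q N * \<mu> (D k)\<close>, so all probabilities in that inequality are controlled by one exponential
bound.\<close>

lemma coupling_maximal_inequality:
  fixes P :: "'w measure" and \<mu> :: "'a measure" and E :: "nat \<Rightarrow> 'w \<Rightarrow> 'a measure"
  assumes "prob_space P" and "finite_measure \<mu>"
    and q: "\<And>n. q n > 0" "incseq q" and coupling: "stochastic_coupling P \<mu> q E"
    and I: "finite I" and D: "\<And>k. k \<in> I \<Longrightarrow> D k \<in> sets \<mu>" "disjoint_family_on D I"
    and t: "0 \<le> t" "t \<le> 1"
    and b: "2 ^ card I * exp (q N * measure \<mu> (space \<mu>) * t\<^sup>2 - t * a) \<le> b" and half: "b \<le> 1 / 2"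
  shows "measure P {\<omega> \<in> space P. \<exists>n\<le>N. 2 * a \<le>
      (\<Sum>k\<in>I. \<bar>measure (E n \<omega>) (D k) - q n * measure \<mu> (D k)\<bar>)} \<le> 2 * b"
proof -
  interpret prob_space P by fact
  interpret \<mu>: finite_measure \<mu> by fact
  let ?H = "restrict_space lborel {0::real..}"
  obtain Y where Y: "poisson_point_process P (\<mu> \<Otimes>\<^sub>M ?H) Y"
    and EY: "\<And>n \<omega> C. \<omega> \<in> space P \<Longrightarrow> C \<in> sets \<mu> \<Longrightarrow>
        emeasure (E n \<omega>) C = emeasure (Y \<omega>) (C \<times> {0..q n})"
    using coupling unfolding stochastic_coupling_def by blast
  define T where "T l = (case l of 0 \<Rightarrow> {0..q 0} | Suc l' \<Rightarrow> {q l'<..q (Suc l')})" for l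
  define \<tau> where "\<tau> l = (case l of 0 \<Rightarrow> q 0 | Suc l' \<Rightarrow> q (Suc l') - q l')" for l
  have mono: "q i \<le> q j" if "i \<le> j" for i j using q(2) that by (rule incseqD)
  have prefix_T: "(\<Union>l\<le>i. T l) = {0..q i}" for i
  proof (induction i)
    case (Suc i)
    then show ?case
      using mono[of i "Suc i"] q(1)[of i] by (auto simp: atMost_Suc T_def)
  qed (simp add: T_def)
  have prefix_\<tau>: "(\<Sum>l\<le>i. \<tau> l) = q i" for i
    by (induction i) (auto simp: \<tau>_def)
  have suffix_T: "(\<Union>l\<in>{i<..<Suc j}. T l) = {q i<..q j}" if "i \<le> j" for i j
    using that
  proof (induction j rule: dec_induct)
    case base
    have "{i<..<Suc i} = {}" by auto
    then show ?case by simp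
  next
    case (step j)
    have "{i<..<Suc (Suc j)} = insert (Suc j) {i<..<Suc j}" using step by auto
    then show ?case
      using step mono[of i j] mono[of j "Suc j"] by (auto simp: T_def)
  qed
  have suffix_\<tau>: "(\<Sum>l\<in>{i<..<Suc j}. \<tau> l) = q j - q i" if "i \<le> j" for i j
  proof -
    have "{..j} = {..i} \<union> {i<..<Suc j}" using that by auto
    then have "(\<Sum>l\<le>j. \<tau> l) = (\<Sum>l\<le>i. \<tau> l) + (\<Sum>l\<in>{i<..<Suc j}. \<tau> l)"
      by (simp add: sum.union_disjoint ivl_disj_int)
    then show ?thesis by (simp add: prefix_\<tau>)
  qed
  have T_disj: "T i \<inter> T j = {}" if "i \<noteq> j" for i j
  proof -
    have *: "T i \<inter> T j = {}" if "i < j" for i j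
    proof -
      obtain j' where j: "j = Suc j'" "i \<le> j'" using \<open>i < j\<close> by (cases j) auto
      have "T i \<subseteq> {0..q i}" using prefix_T[of i] by blast
      then show ?thesis using mono[OF j(2)] by (force simp: T_def j(1))
    qed
    show ?thesis using *[of i j] *[of j i] that by (cases "i < j") auto
  qed
  have sets_H: "B \<in> sets ?H" if "B \<in> sets borel" "B \<subseteq> {0..}" for B
    using that by (subst sets_restrict_space_iff) auto
  have T_sets: "T l \<in> sets ?H" for l
  proof (rule sets_H)
    show "T l \<subseteq> {0..}"
      using prefix_T[of l] by force
  qed (auto simp: T_def split: nat.split)
  have rect: "C \<times> B \<in> sets (\<mu> \<Otimes>\<^sub>M ?H)" if "C \<in> sets \<mu>" "B \<in> sets ?H" for C B
    using that by (rule pair_measureI)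
  have "sigma_finite_measure ?H"
    by (rule sigma_finite_measure_restrict_space) (auto intro: sigma_finite_lborel)
  then interpret H: sigma_finite_measure ?H .
  have intensity: "emeasure (\<mu> \<Otimes>\<^sub>M ?H) (C \<times> B) = ennreal (measure \<mu> C * measure lborel B)"
    if C: "C \<in> sets \<mu>" and B: "B \<in> sets borel" "B \<subseteq> {0..}" "emeasure lborel B \<noteq> \<infinity>" for C B
  proof -
    have "emeasure (\<mu> \<Otimes>\<^sub>M ?H) (C \<times> B) = emeasure \<mu> C * emeasure ?H B"
      using C sets_H[OF B(1,2)] by (rule H.emeasure_pair_measure_Times)
    also have "emeasure ?H B = emeasure lborel B"
      using B by (intro emeasure_restrict_space) auto
    finally show ?thesis
      using B(3) by (simp add: \<mu>.emeasure_eq_measure emeasure_eq_ennreal_measure ennreal_mult)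
  qed
  have Y_meas: "(\<lambda>\<omega>. emeasure (Y \<omega>) B) \<in> borel_measurable P" if "B \<in> sets (\<mu> \<Otimes>\<^sub>M ?H)" for B
    using Y that by (auto simp: poisson_point_process_def point_process_def)
  have Y_sets: "sets (Y \<omega>) = sets (\<mu> \<Otimes>\<^sub>M ?H)" if "\<omega> \<in> space P" for \<omega>
    using Y that by (auto simp: poisson_point_process_def point_process_def)
  have Y_poisson: "poisson_distributed P (\<lambda>\<omega>. emeasure (Y \<omega>) (C \<times> B))
      (ennreal (measure \<mu> C * measure lborel B))"
    if "C \<in> sets \<mu>" "B \<in> sets borel" "B \<subseteq> {0..}" "emeasure lborel B \<noteq> \<infinity>" for C B
    using Y rect[OF that(1) sets_H[OF that(2,3)]] intensity[OF that]
    unfolding poisson_point_process_def by metis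
  define X where "X l k \<omega> = measure (Y \<omega>) (D k \<times> T l) - measure \<mu> (D k) * \<tau> l" for l k \<omega>
  have DT: "D k \<times> T l \<in> sets (\<mu> \<Otimes>\<^sub>M ?H)" if "k \<in> I" for k l
    using D(1) that T_sets by (intro rect) auto

  \<comment> \<open>Real-valued counts are additive only where the process is finite, which holds
    almost surely up to time \<open>q N\<close>.\<close>
  have fin_AE: "AE \<omega> in P. emeasure (Y \<omega>) (space \<mu> \<times> {0..q N}) \<noteq> \<infinity>"
  proof -
    have "AE \<omega> in P. emeasure (Y \<omega>) (space \<mu> \<times> {0..q N}) \<in> range of_nat"
      by (rule poisson_distributed_AE_nat[OF \<open>prob_space P\<close> Y_meas Y_poisson])
        (use less_imp_le[OF q(1)[of N]] in \<open>auto intro!: rect sets_H\<close>)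
    then show ?thesis by eventually_elim auto
  qed
  have sum_X: "(\<Sum>l\<in>L. X l k \<omega>) = measure (Y \<omega>) (D k \<times> (\<Union>l\<in>L. T l)) - measure \<mu> (D k) * (\<Sum>l\<in>L. \<tau> l)"
    if \<omega>: "\<omega> \<in> space P" "emeasure (Y \<omega>) (space \<mu> \<times> {0..q N}) \<noteq> \<infinity>"
      and k: "k \<in> I" and L: "L \<subseteq> {..N}" for L k \<omega>
  proof -
    have "measure (Y \<omega>) (\<Union>l\<in>L. D k \<times> T l) = (\<Sum>l\<in>L. measure (Y \<omega>) (D k \<times> T l))"
    proof (rule measure_finite_Union)
      show "finite L" using L finite_subset by blast
      show "(\<lambda>l. D k \<times> T l) ` L \<subseteq> sets (Y \<omega>)"
        using DT[OF k] by (auto simp: Y_sets[OF \<omega>(1)])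
      show "disjoint_family_on (\<lambda>l. D k \<times> T l) L"
        using T_disj by (fastforce simp: disjoint_family_on_def)
      fix l assume "l \<in> L"
      then have "D k \<times> T l \<subseteq> space \<mu> \<times> {0..q N}"
        using D(1)[OF k, THEN sets.sets_into_space] prefix_T[of N] L by blast
      moreover have "space \<mu> \<times> {0..q N} \<in> sets (Y \<omega>)"
        by (auto simp: Y_sets[OF \<omega>(1)] intro!: rect sets_H)
      ultimately have "emeasure (Y \<omega>) (D k \<times> T l) \<le> emeasure (Y \<omega>) (space \<mu> \<times> {0..q N})"
        by (rule emeasure_mono)
      then show "emeasure (Y \<omega>) (D k \<times> T l) \<noteq> \<infinity>" using \<omega>(2) by (auto simp: top_unique)
    qed
    moreover have "D k \<times> (\<Union>l\<in>L. T l) = (\<Union>l\<in>L. D k \<times> T l)" by auto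
    ultimately show ?thesis
      by (simp add: X_def sum_subtractf sum_distrib_left)
  qed

  have indep: "indep_vars (\<lambda>_. borel) (\<lambda>(l, k). X l k) ({..<Suc N} \<times> I)"
  proof -
    have "indep_vars (\<lambda>_. borel) (\<lambda>p \<omega>. emeasure (Y \<omega>) (D (snd p) \<times> T (fst p))) ({..<Suc N} \<times> I)"
    proof (rule poisson_point_process_indep[OF \<open>prob_space P\<close> Y])
      show "disjoint_family_on (\<lambda>p. D (snd p) \<times> T (fst p)) ({..<Suc N} \<times> I)"
        unfolding disjoint_family_on_def
      proof (intro ballI impI)
        fix p p' assume p: "p \<in> {..<Suc N} \<times> I" "p' \<in> {..<Suc N} \<times> I" "p \<noteq> p'"
        show "D (snd p) \<times> T (fst p) \<inter> D (snd p') \<times> T (fst p') = {}"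
        proof (cases "fst p = fst p'")
          case True
          then have "snd p \<noteq> snd p'" using p by (simp add: prod_eq_iff)
          then have "D (snd p) \<inter> D (snd p') = {}"
            using p disjoint_family_onD[OF D(2), of "snd p" "snd p'"] by (auto simp: mem_Times_iff)
          then show ?thesis by auto
        next
          case False
          then show ?thesis using T_disj by blast
        qed
      qed
    qed (use I DT in auto)
    then have "indep_vars (\<lambda>_. borel) (\<lambda>p \<omega>. (\<lambda>x. enn2real x - measure \<mu> (D (snd p)) * \<tau> (fst p))
        (emeasure (Y \<omega>) (D (snd p) \<times> T (fst p)))) ({..<Suc N} \<times> I)"
      by (rule indep_vars_compose2) measurable
    then show ?thesis
      by (simp add: X_def[abs_def] measure_def case_prod_beta')
  qed

  \<comment> \<open>Any union \<open>B\<close> of windows has length at most \<open>q N\<close>, so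
    the same exponential bound covers both the total sum and every tail in Ottaviani's inequality.\<close>
  have deviation: "measure P {\<omega> \<in> space P. a \<le> (\<Sum>k\<in>I. \<bar>\<Sum>l\<in>L. X l k \<omega>\<bar>)} \<le> b"
    if L: "L \<subseteq> {..N}" and B: "(\<Union>l\<in>L. T l) = B" "B \<in> sets borel" "emeasure lborel B \<noteq> \<infinity>"
      and len: "(\<Sum>l\<in>L. \<tau> l) = measure lborel B" "measure lborel B \<le> q N" for L B
  proof -
    have B0: "B \<subseteq> {0..}"
    proof -
      have "B \<subseteq> (\<Union>l\<le>N. T l)" using L B(1) by blast
      then show ?thesis unfolding prefix_T by auto
    qed
    have DB: "D k \<times> B \<in> sets (\<mu> \<Otimes>\<^sub>M ?H)" if "k \<in> I" for k
      using D(1) that B B0 by (intro rect sets_H) auto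
    let ?W = "\<lambda>k \<omega>. emeasure (Y \<omega>) (D k \<times> B)" and ?m = "\<lambda>k. measure \<mu> (D k) * measure lborel B"
    have [measurable]: "?W k \<in> borel_measurable P" if "k \<in> I" for k
      by (rule Y_meas[OF DB[OF that]])
    have m_sum: "(\<Sum>k\<in>I. ?m k) \<le> q N * measure \<mu> (space \<mu>)"
    proof -
      have "(\<Sum>k\<in>I. measure \<mu> (D k)) = measure \<mu> (\<Union>k\<in>I. D k)"
        using I D by (intro \<mu>.finite_measure_finite_Union[symmetric]) auto
      also have "\<dots> \<le> measure \<mu> (space \<mu>)" by (rule \<mu>.bounded_measure)
      finally show ?thesis
        using len(2) by (subst sum_distrib_right[symmetric], subst mult.commute)
          (intro mult_mono, auto)
    qed
    have indepW: "indep_vars (\<lambda>_. borel) ?W I"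
      using I DB D(2) by (intro poisson_point_process_indep[OF \<open>prob_space P\<close> Y])
        (auto simp: disjoint_family_on_def)
    have "measure P {\<omega> \<in> space P. a \<le> (\<Sum>k\<in>I. \<bar>enn2real (?W k \<omega>) - ?m k\<bar>)}
        \<le> 2 ^ card I * exp (q N * measure \<mu> (space \<mu>) * t\<^sup>2 - t * a)"
      using D(1) B B0 m_sum t
      by (intro poisson_L1_deviation[OF \<open>prob_space P\<close> I indepW] Y_poisson) auto
    moreover have "measure P {\<omega> \<in> space P. a \<le> (\<Sum>k\<in>I. \<bar>\<Sum>l\<in>L. X l k \<omega>\<bar>)}
        \<le> measure P {\<omega> \<in> space P. a \<le> (\<Sum>k\<in>I. \<bar>enn2real (?W k \<omega>) - ?m k\<bar>)}"
    proof (rule finite_measure_mono_AE)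
      show "AE \<omega> in P. \<omega> \<in> {\<omega> \<in> space P. a \<le> (\<Sum>k\<in>I. \<bar>\<Sum>l\<in>L. X l k \<omega>\<bar>)} \<longrightarrow>
          \<omega> \<in> {\<omega> \<in> space P. a \<le> (\<Sum>k\<in>I. \<bar>enn2real (?W k \<omega>) - ?m k\<bar>)}"
        using fin_AE by eventually_elim (auto simp: sum_X L B(1) len(1) measure_def)
    qed measurable
    ultimately show ?thesis using b by linarith
  qed
  have tail: "measure P {\<omega> \<in> space P. a \<le> (\<Sum>k\<in>I. \<bar>\<Sum>l\<in>{i<..<Suc N}. X l k \<omega>\<bar>)} \<le> 1 / 2"
    if "i < Suc N" for i
    using that mono[of i N] q(1)[of i] half
    by (intro order_trans[OF deviation[of "{i<..<Suc N}" "{q i<..q N}"] half])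
      (auto simp: suffix_T suffix_\<tau>)
  have total: "measure P {\<omega> \<in> space P. a \<le> (\<Sum>k\<in>I. \<bar>\<Sum>l<Suc N. X l k \<omega>\<bar>)} \<le> b"
    using less_imp_le[OF q(1)[of N]]
    by (intro deviation[of "{..<Suc N}" "{0..q N}"]) (auto simp: lessThan_Suc_atMost prefix_T prefix_\<tau>)
  have X_meas: "X l k \<in> borel_measurable P" if "k \<in> I" for l k
    using Y_meas[OF DT[OF that]] unfolding X_def measure_def by measurable
  have "measure P {\<omega> \<in> space P. \<exists>n\<le>N. 2 * a \<le>
        (\<Sum>k\<in>I. \<bar>measure (E n \<omega>) (D k) - q n * measure \<mu> (D k)\<bar>)}
      \<le> measure P {\<omega> \<in> space P. \<exists>i<Suc N. 2 * a \<le> (\<Sum>k\<in>I. \<bar>\<Sum>l\<le>i. X l k \<omega>\<bar>)}"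
  proof (rule finite_measure_mono_AE)
    have "(\<lambda>\<omega>. \<Sum>k\<in>I. \<bar>\<Sum>l\<le>i. X l k \<omega>\<bar>) \<in> borel_measurable P" for i
      using X_meas by (intro borel_measurable_sum borel_measurable_abs) auto
    then show "{\<omega> \<in> space P. \<exists>i<Suc N. 2 * a \<le> (\<Sum>k\<in>I. \<bar>\<Sum>l\<le>i. X l k \<omega>\<bar>)} \<in> sets P"
      by measurable
    show "AE \<omega> in P. \<omega> \<in> {\<omega> \<in> space P. \<exists>n\<le>N. 2 * a \<le>
        (\<Sum>k\<in>I. \<bar>measure (E n \<omega>) (D k) - q n * measure \<mu> (D k)\<bar>)} \<longrightarrow>
      \<omega> \<in> {\<omega> \<in> space P. \<exists>i<Suc N. 2 * a \<le> (\<Sum>k\<in>I. \<bar>\<Sum>l\<le>i. X l k \<omega>\<bar>)}"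
      using fin_AE
    proof (eventually_elim, intro impI)
      fix \<omega> assume fin: "emeasure (Y \<omega>) (space \<mu> \<times> {0..q N}) \<noteq> \<infinity>"
        and "\<omega> \<in> {\<omega> \<in> space P. \<exists>n\<le>N. 2 * a \<le>
          (\<Sum>k\<in>I. \<bar>measure (E n \<omega>) (D k) - q n * measure \<mu> (D k)\<bar>)}"
      then obtain n where \<omega>: "\<omega> \<in> space P" and n: "n \<le> N" "2 * a \<le>
          (\<Sum>k\<in>I. \<bar>measure (E n \<omega>) (D k) - q n * measure \<mu> (D k)\<bar>)" by blast
      have "measure (E n \<omega>) (D k) - q n * measure \<mu> (D k) = (\<Sum>l\<le>n. X l k \<omega>)" if "k \<in> I" for k
        using n(1) by (subst sum_X[OF \<omega> fin that])
          (auto simp: prefix_T prefix_\<tau> measure_def EY[OF \<omega> D(1)[OF that]])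
      then have "2 * a \<le> (\<Sum>k\<in>I. \<bar>\<Sum>l\<le>n. X l k \<omega>\<bar>)" using n(2) by simp
      then show "\<omega> \<in> {\<omega> \<in> space P. \<exists>i<Suc N. 2 * a \<le> (\<Sum>k\<in>I. \<bar>\<Sum>l\<le>i. X l k \<omega>\<bar>)}"
        using \<omega> le_imp_less_Suc[OF n(1)] by blast
    qed
  qed
  also have "\<dots> \<le> 2 * measure P {\<omega> \<in> space P. a \<le> (\<Sum>k\<in>I. \<bar>\<Sum>l<Suc N. X l k \<omega>\<bar>)}"
    by (rule ottaviani_L1[OF \<open>prob_space P\<close> I indep tail])
  also have "\<dots> \<le> 2 * b" using total by simp
  finally show ?thesis .
qed
section \<open>Refining a partition\<close>

text \<open>Each \<open>C j\<close> is the disjoint union of the \<open>D i\<close> assigned to it, so the claim is the triangle inequality.  Empty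
\<open>D i\<close> lie in several \<open>C j\<close>; they are assigned to an arbitrary one by a choice function.\<close>

lemma refinement_increases_L1:
  fixes f :: "'a set \<Rightarrow> real"
  assumes fin: "finite I" "finite J"
    and C: "disjoint_family_on C J" and D: "disjoint_family_on D I"
    and cover: "(\<Union>j\<in>J. C j) = (\<Union>i\<in>I. D i)"
    and refines: "\<And>i. i \<in> I \<Longrightarrow> \<exists>j\<in>J. D i \<subseteq> C j"
    and additive: "\<And>A. A \<subseteq> I \<Longrightarrow> f (\<Union>i\<in>A. D i) = (\<Sum>i\<in>A. f (D i))"
  shows "(\<Sum>j\<in>J. \<bar>f (C j)\<bar>) \<le> (\<Sum>i\<in>I. \<bar>f (D i)\<bar>)"
proof -
  obtain g where g: "\<And>i. i \<in> I \<Longrightarrow> g i \<in> J \<and> D i \<subseteq> C (g i)"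
    using refines by metis
  have C_eq: "C j = (\<Union>i\<in>{i \<in> I. g i = j}. D i)" if j: "j \<in> J" for j
  proof
    show "C j \<subseteq> (\<Union>i\<in>{i \<in> I. g i = j}. D i)"
    proof
      fix x assume x: "x \<in> C j"
      then obtain i where i: "i \<in> I" "x \<in> D i" using cover j by blast
      then have "x \<in> C (g i)" "g i \<in> J" using g by auto
      then have "g i = j" using C x j unfolding disjoint_family_on_def by blast
      then show "x \<in> (\<Union>i\<in>{i \<in> I. g i = j}. D i)" using i by blast
    qed
    show "(\<Union>i\<in>{i \<in> I. g i = j}. D i) \<subseteq> C j" using g by blast
  qed
  have "(\<Sum>j\<in>J. \<bar>f (C j)\<bar>) = (\<Sum>j\<in>J. \<bar>\<Sum>i\<in>{i \<in> I. g i = j}. f (D i)\<bar>)"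
    by (intro sum.cong refl) (simp add: C_eq additive)
  also have "\<dots> \<le> (\<Sum>j\<in>J. \<Sum>i\<in>{i \<in> I. g i = j}. \<bar>f (D i)\<bar>)"
    by (intro sum_mono sum_abs)
  also have "\<dots> = (\<Sum>i\<in>I. \<bar>f (D i)\<bar>)"
    using fin g by (intro sum.group) auto
  finally show ?thesis .
qed

section \<open>Choosing the exponential parameter\<close>

lemma square_bound_of_sqrt_smallo:
  fixes x q r :: "nat \<Rightarrow> real"
  assumes q: "\<And>n. q n > 0" and o: "(\<lambda>n. sqrt (x n / q n)) \<in> o(r)" and c: "0 < c"
  shows "\<forall>\<^sub>F n in sequentially. x n \<le> c * (q n * (r n)\<^sup>2)"
proof -
  have "\<forall>\<^sub>F n in sequentially. norm (sqrt (x n / q n)) \<le> sqrt c * norm (r n)"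
    using c by (intro landau_o.smallD[OF o]) simp
  then show ?thesis
  proof eventually_elim
    case (elim n)
    \<comment> \<open>For negative \<open>x n\<close> the square root is negative too, but then the bound is trivial.\<close>
    have "x n / q n \<le> (sqrt (x n / q n))\<^sup>2"
      by (cases "0 \<le> x n / q n") (auto intro: order_trans[of _ 0])
    also have "\<dots> \<le> (sqrt c * norm (r n))\<^sup>2"
      using power_mono[OF elim, of 2] by simp
    also have "\<dots> = c * (r n)\<^sup>2"
      using c by (simp add: power_mult_distrib)
    finally show ?case
      using q[of n] by (simp add: field_simps)
  qed
qed

text \<open>With \<open>t\<close> proportional to \<open>r n\<close> the exponent is a negative multiple of \<open>q n * (r n)\<^sup>2\<close>, and this quantity
eventually exceeds any fixed multiple of \<open>K n\<close> and of \<open>L n\<close>.  The boundedness of \<open>r\<close> keeps \<open>t\<close> in the unit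
interval, where the quadratic bound on the exponential is valid.\<close>

lemma eventually_chernoff_bound:
  fixes q r L :: "nat \<Rightarrow> real" and K :: "nat \<Rightarrow> nat"
  assumes q: "\<And>n. q n > 0" and r: "\<And>n. r n > 0" and R: "\<And>n. r n \<le> R"
    and K: "(\<lambda>n. sqrt (real (K n) / q n)) \<in> o(r)"
    and L: "(\<lambda>n. sqrt (L n / q n)) \<in> o(r)"
    and \<Lambda>: "0 \<le> \<Lambda>" and \<epsilon>: "0 < \<epsilon>"
  shows "\<forall>\<^sub>F n in sequentially. \<exists>t. 0 \<le> t \<and> t \<le> 1 \<and>
    2 ^ K n * exp (q n * \<Lambda> * t\<^sup>2 - t * (\<epsilon> * (q n * r n))) \<le> exp (- 2 * L n)"
proof -
  have "0 < R" using r[of 0] R[of 0] by linarith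
  \<comment> \<open>The exponential parameter will be \<open>t = \<delta> * r n\<close>:
    \<open>\<delta> \<le> 1 / R\<close> keeps it at most \<open>1\<close>, and
    \<open>\<delta> * \<Lambda> \<le> \<epsilon> / 2\<close> lets the linear term absorb the quadratic one.\<close>
  define \<delta> where "\<delta> = min (1 / R) (\<epsilon> / 2 / (\<Lambda> + 1))"
  have \<delta>: "0 < \<delta>" using \<Lambda> \<epsilon> \<open>0 < R\<close> by (simp add: \<delta>_def)
  have \<delta>\<Lambda>: "\<Lambda> * \<delta> \<le> \<epsilon> / 2"
  proof -
    have "\<Lambda> * \<delta> \<le> (\<Lambda> + 1) * (\<epsilon> / 2 / (\<Lambda> + 1))"
      using \<Lambda> \<delta> by (intro mult_mono) (auto simp: \<delta>_def)
    also have "\<dots> = \<epsilon> / 2" using \<Lambda> by (simp del: divide_divide_eq_left)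
    finally show ?thesis .
  qed
  \<comment> \<open>Of the total gain \<open>\<epsilon> * \<delta> / 2 = 4 * c\<close> (times
    \<open>q n * (r n)\<^sup>2\<close>), one unit \<open>c\<close> pays for \<open>2 ^ K n\<close>
    and two units pay for \<open>2 * L n\<close>.\<close>
  define c where "c = \<epsilon> * \<delta> / 8"
  have c: "0 < c" using \<epsilon> \<delta> by (simp add: c_def)
  show ?thesis
    using square_bound_of_sqrt_smallo[OF q K c] square_bound_of_sqrt_smallo[OF q L c]
  proof eventually_elim
    case (elim n)
    let ?s = "q n * (r n)\<^sup>2"
    have s: "0 \<le> ?s" using q[of n] by simp
    have "\<delta> * r n \<le> 1 / R * R"
      using r[of n] R[of n] \<open>0 < R\<close> \<delta> by (intro mult_mono) (auto simp: \<delta>_def)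
    then have t1: "\<delta> * r n \<le> 1" using \<open>0 < R\<close> by simp
    have "q n * \<Lambda> * (\<delta> * r n)\<^sup>2 - \<delta> * r n * (\<epsilon> * (q n * r n)) = (\<Lambda> * \<delta>) * (\<delta> * ?s) - \<epsilon> * (\<delta> * ?s)"
      by (simp add: power2_eq_square algebra_simps)
    also have "\<dots> \<le> \<epsilon> / 2 * (\<delta> * ?s) - \<epsilon> * (\<delta> * ?s)"
      using \<delta> s by (intro diff_right_mono mult_right_mono \<delta>\<Lambda>) simp
    also have "\<dots> = - (4 * (c * ?s))" by (simp add: c_def)
    finally have expo: "q n * \<Lambda> * (\<delta> * r n)\<^sup>2 - \<delta> * r n * (\<epsilon> * (q n * r n)) \<le> - (4 * (c * ?s))" .
    have "(2::real) ^ K n \<le> exp (real (K n))"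
      using power_mono[of 2 "exp 1 :: real" "K n"] exp_ge_add_one_self[of "1 :: real"]
      by (simp add: exp_of_nat_mult[symmetric])
    then have "2 ^ K n * exp (q n * \<Lambda> * (\<delta> * r n)\<^sup>2 - \<delta> * r n * (\<epsilon> * (q n * r n)))
      \<le> exp (real (K n)) * exp (- (4 * (c * ?s)))"
      using expo by (intro mult_mono) auto
    also have "\<dots> \<le> exp (- 2 * L n)"
      using elim s c mult_nonneg_nonneg[of c ?s] by (simp add: exp_add[symmetric])
    finally show ?case
      using \<delta> r[of n] t1 by (intro exI[of _ "\<delta> * r n"]) simp
  qed
qed

section \<open>Deviations are eventually small\<close>

text \<open>With \<open>L = ln n\<close> the exceptional probabilities are at most \<open>1 / n\<^sup>2\<close>, hence summable
whatever the joint law of the processes, and the Borel-Cantelli lemma applies.\<close>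

lemma deviation_small_of_arbitrary_coupling:
  fixes P :: "'w measure" and \<mu> :: "'a measure"
    and K :: "nat \<Rightarrow> nat" and C :: "nat \<Rightarrow> nat \<Rightarrow> 'a set" and q r :: "nat \<Rightarrow> real"
  assumes "prob_space P" and "finite_measure \<mu>"
    and part: "\<And>n k. k \<in> {1..K n} \<Longrightarrow> C n k \<in> sets \<mu>" "\<And>n. disjoint_family_on (C n) {1..K n}"
      "\<And>n. (\<Union>k\<in>{1..K n}. C n k) = space \<mu>"
    and q: "\<And>n. q n > 0" and r: "\<And>n. r n > 0" "\<And>n. r n \<le> R"
    and K: "(\<lambda>n. sqrt (real (K n) / q n)) \<in> o(r)"
    and E: "\<And>n. poisson_point_process P (scale_measure (ennreal (q n)) \<mu>) (E n)"
    and \<epsilon>: "0 < \<epsilon>"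
    and L: "(\<lambda>n. sqrt (ln (real n) / q n)) \<in> o(r)"
  shows "AE \<omega> in P. \<forall>\<^sub>F n in sequentially.
    (\<Sum>k\<in>{1..K n}. \<bar>measure (E n \<omega>) (C n k) - q n * measure \<mu> (C n k)\<bar>) < \<epsilon> * (q n * r n)"
proof -
  interpret prob_space P by fact
  interpret \<mu>: finite_measure \<mu> by fact
  define \<Delta> where "\<Delta> n \<omega> = (\<Sum>k\<in>{1..K n}. \<bar>measure (E n \<omega>) (C n k) - q n * measure \<mu> (C n k)\<bar>)" for n \<omega>
  note E_meas = scaled_poisson_process_count(1)[OF \<open>finite_measure \<mu>\<close> E less_imp_le[OF q]]
  note E_poisson = scaled_poisson_process_count(2)[OF \<open>finite_measure \<mu>\<close> E less_imp_le[OF q]]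
  have \<Delta>_meas[measurable]: "\<Delta> n \<in> borel_measurable P" for n
    using E_meas part(1) unfolding \<Delta>_def measure_def
    by (intro borel_measurable_sum borel_measurable_abs) auto
  define A where "A n = {\<omega> \<in> space P. \<epsilon> * (q n * r n) \<le> \<Delta> n \<omega>}" for n
  have "\<forall>\<^sub>F n in sequentially. norm (measure P (A n)) \<le> inverse (real n ^ 2)"
    using eventually_chernoff_bound[OF q r K L measure_nonneg \<epsilon>, of \<mu> "space \<mu>"]
      eventually_gt_at_top[of 0]
  proof eventually_elim
    case (elim n)
    then obtain t where t: "0 \<le> t" "t \<le> 1" and
      bound: "2 ^ K n * exp (q n * measure \<mu> (space \<mu>) * t\<^sup>2 - t * (\<epsilon> * (q n * r n)))
        \<le> exp (- 2 * ln (real n))" by blast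
    have "(\<Sum>k\<in>{1..K n}. measure \<mu> (C n k)) = measure \<mu> (space \<mu>)"
      using part by (subst \<mu>.finite_measure_finite_Union[symmetric]) auto
    then have "(\<Sum>k\<in>{1..K n}. q n * measure \<mu> (C n k)) \<le> q n * measure \<mu> (space \<mu>)"
      by (simp add: sum_distrib_left[symmetric])
    then have "measure P (A n) \<le>
        2 ^ card {1..K n} * exp (q n * measure \<mu> (space \<mu>) * t\<^sup>2 - t * (\<epsilon> * (q n * r n)))"
      unfolding A_def \<Delta>_def measure_def[of "E n _"]
      using part q[of n] t
      by (intro poisson_L1_deviation \<open>prob_space P\<close> E_poisson
          poisson_point_process_indep[OF \<open>prob_space P\<close> E]) auto
    also have "\<dots> \<le> exp (- 2 * ln (real n))" using bound by simp
    also have "\<dots> = inverse (real n ^ 2)"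
      using elim(2) exp_of_nat_mult[of 2 "ln (real n)"] by (simp add: exp_minus)
    finally show ?case by simp
  qed
  then have "summable (\<lambda>n. measure P (A n))"
    by (rule summable_comparison_test_ev) (rule inverse_power_summable, simp)
  then have "AE \<omega> in P. \<forall>\<^sub>F n in sequentially. \<omega> \<in> space P - A n"
    by (intro borel_cantelli_AE1) (auto simp: A_def emeasure_eq_measure)
  then show ?thesis
    by eventually_elim (auto simp: A_def \<Delta>_def elim!: eventually_mono)
qed

text \<open>A bounded increasing positive sequence stays between two positive constants.  Thus in either monotone case an
estimate at the end of a dyadic block transfers, up to a constant, to the earlier indices of the block.\<close>

lemma monotone_quasi_decreasing:
  fixes r :: "nat \<Rightarrow> real"
  assumes "monoseq r" and r: "\<And>n. r n > 0" "\<And>n. r n \<le> R"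
  obtains c where "0 < c" and "\<And>n N. n \<le> N \<Longrightarrow> c * r N \<le> r n"
proof (cases "decseq r")
  case True
  then show ?thesis by (intro that[of 1]) (auto dest: decseqD)
next
  case False
  then have "incseq r" using \<open>monoseq r\<close> by (auto simp: monoseq_iff)
  have "0 < R" using r(1)[of 0] r(2)[of 0] by linarith
  show ?thesis
  proof (rule that[of "r 0 / R"])
    show "0 < r 0 / R" using r(1)[of 0] \<open>0 < R\<close> by simp
    fix n N :: nat
    have "r 0 / R * r N \<le> r 0 / R * R"
      using r(2)[of N] r(1)[of 0] \<open>0 < R\<close> by (intro mult_left_mono) auto
    also have "\<dots> \<le> r n" using \<open>0 < R\<close> incseqD[OF \<open>incseq r\<close>, of 0 n] by simp
    finally show "r 0 / R * r N \<le> r n" .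
  qed
qed

text \<open>Here \<open>A j\<close> is the event that the deviation is large for some index of the \<open>j\<close>-th dyadic block.  It is compared
with the maximal deviation on the partition of the last index \<open>N\<close> of the block; since \<open>ln (q N) \<ge> j * ln 2\<close>, a bound
of order \<open>exp (- 2 * ln (ln (q N)))\<close> is summable over the blocks although it need not be summable over the
indices.\<close>

lemma deviation_small_of_nested_coupling:
  fixes P :: "'w measure" and \<mu> :: "'a measure"
    and K :: "nat \<Rightarrow> nat" and C :: "nat \<Rightarrow> nat \<Rightarrow> 'a set" and q r :: "nat \<Rightarrow> real"
  assumes "prob_space P" and "finite_measure \<mu>"
    and part: "\<And>n k. k \<in> {1..K n} \<Longrightarrow> C n k \<in> sets \<mu>" "\<And>n. disjoint_family_on (C n) {1..K n}"
      "\<And>n. (\<Union>k\<in>{1..K n}. C n k) = space \<mu>"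
    and q: "\<And>n. q n > 0" "incseq q" "filterlim q at_top sequentially" and r: "\<And>n. r n > 0" "\<And>n. r n \<le> R"
    and c: "0 < c" and rc: "\<And>n N. n \<le> N \<Longrightarrow> c * r N \<le> r n"
    and K: "(\<lambda>n. sqrt (real (K n) / q n)) \<in> o(r)"
    and E: "\<And>n. poisson_point_process P (scale_measure (ennreal (q n)) \<mu>) (E n)"
    and \<epsilon>: "0 < \<epsilon>"
    and coupling: "stochastic_coupling P \<mu> q E"
    and L: "(\<lambda>n. sqrt (ln (ln (q n)) / q n)) \<in> o(r)"
    and nested: "\<forall>n. \<forall>k\<in>{1..K (Suc n)}. \<exists>k'\<in>{1..K n}. C (Suc n) k \<subseteq> C n k'"
  shows "AE \<omega> in P. \<forall>\<^sub>F n in sequentially.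
    (\<Sum>k\<in>{1..K n}. \<bar>measure (E n \<omega>) (C n k) - q n * measure \<mu> (C n k)\<bar>) < \<epsilon> * (q n * r n)"
proof -
  interpret prob_space P by fact
  interpret \<mu>: finite_measure \<mu> by fact
  define \<Delta> where "\<Delta> n \<omega> = (\<Sum>k\<in>{1..K n}. \<bar>measure (E n \<omega>) (C n k) - q n * measure \<mu> (C n k)\<bar>)" for n \<omega>
  note E_meas = scaled_poisson_process_count(1)[OF \<open>finite_measure \<mu>\<close> E less_imp_le[OF q(1)]]
  note E_poisson = scaled_poisson_process_count(2)[OF \<open>finite_measure \<mu>\<close> E less_imp_le[OF q(1)]]
  have \<Delta>_meas[measurable]: "\<Delta> n \<in> borel_measurable P" for n
    using E_meas part(1) unfolding \<Delta>_def measure_def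
    by (intro borel_measurable_sum borel_measurable_abs) auto
  have q_mono: "q i \<le> q j" if "i \<le> j" for i j using q(2) that by (rule incseqD)
  have refines: "\<exists>k'\<in>{1..K n}. C N k \<subseteq> C n k'" if "n \<le> N" "k \<in> {1..K N}" for n N k
    using that
  proof (induction N arbitrary: k rule: dec_induct)
    case (step N)
    then obtain k' where "k' \<in> {1..K N}" "C (Suc N) k \<subseteq> C N k'" using nested by blast
    with step.IH[of k'] show ?case by blast
  qed blast
  \<comment> \<open>A factor \<open>2\<close> is lost in Ottaviani's inequality, another \<open>2\<close> in \<open>q N \<le> 2 * q n\<close> within
    a block, and \<open>c\<close> in comparing \<open>r N\<close> with \<open>r n\<close>.\<close>
  define \<eta> where "\<eta> = \<epsilon> * c / 4"
  have \<eta>: "0 < \<eta>" using \<epsilon> c by (simp add: \<eta>_def)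
  \<comment> \<open>Intensity and partition carry separate indices, so that the partition can be frozen over a block.\<close>
  define \<Phi> where "\<Phi> N n \<omega> = (\<Sum>k\<in>{1..K N}. \<bar>measure (E n \<omega>) (C N k) - q n * measure \<mu> (C N k)\<bar>)"
    for N n \<omega>
  have \<Phi>_meas[measurable]: "\<Phi> N n \<in> borel_measurable P" for N n
    using E_meas part(1) unfolding \<Phi>_def measure_def
    by (intro borel_measurable_sum borel_measurable_abs) auto
  have fin_AE: "AE \<omega> in P. \<forall>n. emeasure (E n \<omega>) (space \<mu>) \<noteq> \<infinity>"
  proof (subst AE_all_countable, rule allI)
    fix n
    have "AE \<omega> in P. emeasure (E n \<omega>) (space \<mu>) \<in> range of_nat"
      using q(1)[of n]
      by (intro poisson_distributed_AE_nat[OF \<open>prob_space P\<close> E_meas E_poisson]) auto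
    then show "AE \<omega> in P. emeasure (E n \<omega>) (space \<mu>) \<noteq> \<infinity>" by eventually_elim auto
  qed
  have \<Delta>_le_\<Phi>: "\<Delta> n \<omega> \<le> \<Phi> N n \<omega>"
    if nN: "n \<le> N" and \<omega>: "\<omega> \<in> space P" and fin: "emeasure (E n \<omega>) (space \<mu>) \<noteq> \<infinity>" for n N \<omega>
    unfolding \<Delta>_def \<Phi>_def
  proof (rule refinement_increases_L1)
    have sets_E: "sets (E n \<omega>) = sets \<mu>"
      using E[of n] \<omega> by (auto simp: poisson_point_process_def point_process_def)
    fix A assume A: "A \<subseteq> {1..K N}"
    then have A': "finite A" "\<And>k. k \<in> A \<Longrightarrow> C N k \<in> sets \<mu>" "disjoint_family_on (C N) A"
      using part(1)[where n=N] disjoint_family_on_mono[OF _ part(2)[of N]] by (auto intro: finite_subset)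
    have "measure (E n \<omega>) (\<Union>k\<in>A. C N k) = (\<Sum>k\<in>A. measure (E n \<omega>) (C N k))"
    proof (rule measure_finite_Union)
      fix k assume "k \<in> A"
      then have "emeasure (E n \<omega>) (C N k) \<le> emeasure (E n \<omega>) (space \<mu>)"
        using A'(2) by (intro emeasure_mono) (auto simp: sets_E dest: sets.sets_into_space)
      then show "emeasure (E n \<omega>) (C N k) \<noteq> \<infinity>" using fin by (auto simp: top_unique)
    qed (use A' sets_E in auto)
    moreover have "measure \<mu> (\<Union>k\<in>A. C N k) = (\<Sum>k\<in>A. measure \<mu> (C N k))"
      using A' by (intro \<mu>.finite_measure_finite_Union) auto
    ultimately show "measure (E n \<omega>) (\<Union>k\<in>A. C N k) - q n * measure \<mu> (\<Union>k\<in>A. C N k)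
        = (\<Sum>k\<in>A. measure (E n \<omega>) (C N k) - q n * measure \<mu> (C N k))"
      by (simp add: sum_subtractf sum_distrib_left)
  qed (use part refines[OF nN] in auto)

  define blk where "blk j = {n. 2 ^ j \<le> q n \<and> q n < 2 ^ Suc j}" for j :: nat
  define A where "A j = {\<omega> \<in> space P. \<exists>n\<in>blk j. \<epsilon> * (q n * r n) \<le> \<Delta> n \<omega>}" for j
  have A_sets[measurable]: "A j \<in> sets P" for j
    unfolding A_def by measurable
  have blk_finite: "finite (blk j)" for j
  proof -
    obtain n0 where "\<And>n. n \<ge> n0 \<Longrightarrow> 2 ^ Suc j \<le> q n"
      using q(3) unfolding filterlim_at_top eventually_sequentially by blast
    then have "blk j \<subseteq> {..<n0}" unfolding blk_def by (force simp: not_le[symmetric])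
    then show ?thesis by (rule finite_subset) simp
  qed
  \<comment> \<open>\<open>ln (q N) \<ge> 2\<close> makes the probability bound at most \<open>1 / 2\<close>,
    as Ottaviani's inequality requires.\<close>
  have "\<forall>\<^sub>F N in sequentially. 2 \<le> ln (q N)"
    by (rule eventually_compose_filterlim[OF _ filterlim_compose[OF ln_at_top q(3)]])
      (rule eventually_ge_at_top)
  then have "\<forall>\<^sub>F N in sequentially. 2 \<le> ln (q N) \<and> (\<exists>t. 0 \<le> t \<and> t \<le> 1 \<and>
    2 ^ K N * exp (q N * measure \<mu> (space \<mu>) * t\<^sup>2 - t * (\<eta> * (q N * r N)))
      \<le> exp (- 2 * ln (ln (q N))))"
    using eventually_chernoff_bound[OF q(1) r(1,2) K L measure_nonneg \<eta>, of \<mu> "space \<mu>"]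
    by eventually_elim auto
  then obtain n0 where n0: "\<And>N. n0 \<le> N \<Longrightarrow> 2 \<le> ln (q N)"
    "\<And>N. n0 \<le> N \<Longrightarrow> (\<exists>t. 0 \<le> t \<and> t \<le> 1 \<and>
    2 ^ K N * exp (q N * measure \<mu> (space \<mu>) * t\<^sup>2 - t * (\<eta> * (q N * r N)))
      \<le> exp (- 2 * ln (ln (q N))))"
    unfolding eventually_sequentially by blast
  obtain j0 where j0: "q n0 < 2 ^ j0"
    using real_arch_pow[of 2 "q n0"] by auto
  have A_bound: "norm (measure P (A j)) \<le> 2 / (ln 2)\<^sup>2 * inverse (real j ^ 2)"
    if j: "Suc j0 \<le> j" for j
  proof (cases "blk j = {}")
    case True
    then show ?thesis by (simp add: A_def)
  next
    case False
    define N where "N = Max (blk j)"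
    have N: "N \<in> blk j" "\<And>n. n \<in> blk j \<Longrightarrow> n \<le> N"
      using blk_finite False by (auto simp: N_def)
    have "(2::real) ^ j0 \<le> 2 ^ j" using j by (intro power_increasing) auto
    moreover have "2 ^ j \<le> q N" using N(1) by (simp add: blk_def)
    ultimately have "q n0 < q N" using j0 by linarith
    then have "n0 \<le> N" using q_mono[of N n0] by (rule_tac ccontr) auto
    then obtain t where t: "0 \<le> t" "t \<le> 1" and
      bound: "2 ^ K N * exp (q N * measure \<mu> (space \<mu>) * t\<^sup>2 - t * (\<eta> * (q N * r N)))
        \<le> exp (- 2 * ln (ln (q N)))" using n0(2) by blast
    have lnq2: "2 \<le> ln (q N)" using n0(1) \<open>n0 \<le> N\<close> .
    have eq: "exp (- 2 * ln (ln (q N))) = inverse ((ln (q N))\<^sup>2)"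
      using lnq2 exp_of_nat_mult[of 2 "ln (ln (q N))"] by (simp add: exp_minus)
    have "(2::real)\<^sup>2 \<le> (ln (q N))\<^sup>2" using lnq2 by (intro power_mono) auto
    then have half: "exp (- 2 * ln (ln (q N))) \<le> 1 / 2"
      using le_imp_inverse_le[of 4 "(ln (q N))\<^sup>2"] unfolding eq by simp
    have "measure P (A j) \<le> measure P {\<omega> \<in> space P. \<exists>n\<le>N. 2 * (\<eta> * (q N * r N)) \<le> \<Phi> N n \<omega>}"
    proof (rule finite_measure_mono_AE)
      show "AE \<omega> in P. \<omega> \<in> A j \<longrightarrow>
          \<omega> \<in> {\<omega> \<in> space P. \<exists>n\<le>N. 2 * (\<eta> * (q N * r N)) \<le> \<Phi> N n \<omega>}"
        using fin_AE
      proof (eventually_elim, intro impI)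
        fix \<omega> assume fin: "\<forall>n. emeasure (E n \<omega>) (space \<mu>) \<noteq> \<infinity>" and "\<omega> \<in> A j"
        then obtain n where \<omega>: "\<omega> \<in> space P" and n: "n \<in> blk j" "\<epsilon> * (q n * r n) \<le> \<Delta> n \<omega>"
          by (auto simp: A_def)
        have "q N \<le> 2 * q n" using n(1) N(1) by (auto simp: blk_def)
        then have "q N * (c * r N) \<le> 2 * q n * r n"
          using rc[OF N(2)[OF n(1)]] r(1)[of N] c q(1)[of n] by (intro mult_mono) auto
        then have "\<epsilon> / 2 * (q N * (c * r N)) \<le> \<epsilon> / 2 * (2 * q n * r n)"
          using \<epsilon> by (intro mult_left_mono) auto
        then have "2 * (\<eta> * (q N * r N)) \<le> \<epsilon> * (q n * r n)"
          by (simp add: \<eta>_def algebra_simps)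
        also have "\<dots> \<le> \<Phi> N n \<omega>"
          using n(2) \<Delta>_le_\<Phi>[OF N(2)[OF n(1)] \<omega>] fin by force
        finally show "\<omega> \<in> {\<omega> \<in> space P. \<exists>n\<le>N. 2 * (\<eta> * (q N * r N)) \<le> \<Phi> N n \<omega>}"
          using \<omega> N(2)[OF n(1)] by blast
      qed
    qed measurable
    also have "\<dots> \<le> 2 * exp (- 2 * ln (ln (q N)))"
      unfolding \<Phi>_def using part(1,2) bound
      by (intro coupling_maximal_inequality[OF \<open>prob_space P\<close> \<open>finite_measure \<mu>\<close> q(1,2)
            coupling _ _ _ t _ half]) auto
    also have "\<dots> \<le> 2 * inverse ((real j * ln 2)\<^sup>2)"
    proof -
      have "0 < j" using j by simp
      have "real j * ln 2 = ln (2 ^ j)" by (simp add: ln_realpow)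
      also have "\<dots> \<le> ln (q N)" using N(1) q(1)[of N] by (simp add: blk_def)
      finally show ?thesis
        unfolding eq using \<open>0 < j\<close> by (intro mult_left_mono le_imp_inverse_le power_mono) auto
    qed
    also have "\<dots> = 2 / (ln 2)\<^sup>2 * inverse (real j ^ 2)"
      by (simp add: field_simps power_mult_distrib)
    finally show ?thesis by simp
  qed
  have "summable (\<lambda>j. measure P (A j))"
  proof (rule summable_comparison_test_ev)
    show "\<forall>\<^sub>F j in sequentially. norm (measure P (A j)) \<le> 2 / (ln 2)\<^sup>2 * inverse (real j ^ 2)"
      using A_bound by (auto simp: eventually_sequentially)
    show "summable (\<lambda>j. 2 / (ln 2)\<^sup>2 * inverse (real j ^ 2))"
      by (intro summable_mult inverse_power_summable) simp
  qed
  then have "AE \<omega> in P. \<forall>\<^sub>F j in sequentially. \<omega> \<in> space P - A j"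
    by (intro borel_cantelli_AE1) (auto simp: emeasure_eq_measure)
  then show ?thesis
  proof eventually_elim
    case (elim \<omega>)
    then obtain J where J: "\<And>j. J \<le> j \<Longrightarrow> \<omega> \<in> space P - A j"
      unfolding eventually_sequentially by blast
    have "\<forall>\<^sub>F n in sequentially. 2 ^ J \<le> q n"
      using q(3) by (auto simp: filterlim_at_top)
    then show ?case
    proof eventually_elim
      case (elim n)
      \<comment> \<open>Every large \<open>n\<close> lies in a late block: take the least power of two
        above \<open>q n\<close>.\<close>
      define m where "m = (LEAST m. q n < 2 ^ m)"
      have "\<exists>m. q n < 2 ^ m" using real_arch_pow[of 2 "q n"] by simp
      then have m: "q n < 2 ^ m" unfolding m_def by (rule LeastI_ex)
      have "(2::real) ^ J < 2 ^ m" using elim m by linarith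
      then have "J < m" by simp
      then obtain j where j: "m = Suc j" "J \<le> j" by (cases m) auto
      have "\<not> q n < 2 ^ j"
        using not_less_Least[of j "\<lambda>m. q n < 2 ^ m"] j(1) by (simp add: m_def[symmetric])
      then have "n \<in> blk j" using m j by (simp add: blk_def)
      then show ?case using J[OF j(2)] by (force simp: A_def \<Delta>_def not_le)
    qed
  qed
qed

section \<open>Almost sure convergence\<close>

lemma AE_tendsto_zeroI:
  fixes f :: "nat \<Rightarrow> 'w \<Rightarrow> real"
  assumes "\<And>\<epsilon>. 0 < \<epsilon> \<Longrightarrow> AE \<omega> in P. \<forall>\<^sub>F n in sequentially. \<bar>f n \<omega>\<bar> < \<epsilon>"
  shows "AE \<omega> in P. (\<lambda>n. f n \<omega>) \<longlonglongrightarrow> 0"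
proof -
  have "AE \<omega> in P. \<forall>p::nat. \<forall>\<^sub>F n in sequentially. \<bar>f n \<omega>\<bar> < 1 / real (Suc p)"
    by (subst AE_all_countable) (auto intro!: assms)
  then show ?thesis
  proof eventually_elim
    case (elim \<omega>)
    show ?case
    proof (rule tendstoI)
      fix e :: real assume "0 < e"
      then obtain p where "1 / real (Suc p) < e"
        using nat_approx_posE by blast
      with elim show "\<forall>\<^sub>F n in sequentially. dist (f n \<omega>) 0 < e"
        by (auto elim!: eventually_mono dest!: spec[of _ p])
    qed
  qed
qed

theorem theorem2p3:
  fixes P :: "'w measure" and \<mu> :: "'a measure"
    and K :: "nat \<Rightarrow> nat" and C :: "nat \<Rightarrow> nat \<Rightarrow> 'a set"
    and q r :: "nat \<Rightarrow> real" and r_lim :: real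
    and E :: "nat \<Rightarrow> 'w \<Rightarrow> 'a measure"
  assumes "prob_space P"
    and "finite_measure \<mu>" and "\<nexists>A. is_atom \<mu> A"
    and "\<And>n k. k \<in> {1..K n} \<Longrightarrow> C n k \<in> sets \<mu>"
    and "\<And>n. disjoint_family_on (C n) {1..K n}"
    and "\<And>n. (\<Union>k\<in>{1..K n}. C n k) = space \<mu>"
    and "incseq K"
    and "\<And>n. q n > 0" and "monoseq q" and "filterlim q at_top sequentially"
    and "\<And>n. r n > 0" and "monoseq r" and "r \<longlonglongrightarrow> r_lim" and "r_lim \<ge> 0"
    and "(\<lambda>n. sqrt (real (K n) / q n)) \<in> o(r)"
    and "\<And>n. poisson_point_process P (scale_measure (ennreal (q n)) \<mu>) (E n)"
    and "(\<lambda>n. sqrt (ln (real n) / q n)) \<in> o(r) \<or>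
         (stochastic_coupling P \<mu> q E \<and>
          (\<lambda>n. sqrt (ln (ln (q n)) / q n)) \<in> o(r) \<and>
          (\<forall>n. \<forall>k\<in>{1..K (Suc n)}. \<exists>k'\<in>{1..K n}. C (Suc n) k \<subseteq> C n k'))"
  shows "AE \<omega> in P.
    (\<lambda>n. 1 / r n * (\<Sum>k\<in>{1..K n}. \<bar>1 / q n * measure (E n \<omega>) (C n k) - measure \<mu> (C n k)\<bar>))
      \<longlonglongrightarrow> 0"
proof -
  note q = assms(8,9,10) and r = assms(11,12,13)
  obtain R where R: "\<And>n. r n \<le> R"
    using convergent_imp_Bseq[OF convergentI[OF r(3)]] unfolding Bseq_def real_norm_def
    by (metis abs_le_D1)
  have q_inc: "incseq q"
  proof (rule ccontr)
    assume "\<not> incseq q"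
    then have "decseq q" using q(2) by (auto simp: monoseq_iff)
    moreover obtain n where "q 0 < q n"
      using q(3) by (metis eventually_sequentially filterlim_at_top_dense le_refl)
    ultimately show False using decseqD[of q 0 n] by simp
  qed
  obtain c where c: "0 < c" "\<And>n N. n \<le> N \<Longrightarrow> c * r N \<le> r n"
    using monotone_quasi_decreasing[OF r(2,1) R] by blast
  define \<Delta> where "\<Delta> n \<omega> = (\<Sum>k\<in>{1..K n}. \<bar>measure (E n \<omega>) (C n k) - q n * measure \<mu> (C n k)\<bar>)" for n \<omega>
  have small: "AE \<omega> in P. \<forall>\<^sub>F n in sequentially. \<Delta> n \<omega> < \<epsilon> * (q n * r n)" if "0 < \<epsilon>" for \<epsilon>
    unfolding \<Delta>_def using assms(17)
  proof (elim disjE conjE)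
    assume "(\<lambda>n. sqrt (ln (real n) / q n)) \<in> o(r)"
    then show "AE \<omega> in P. \<forall>\<^sub>F n in sequentially.
        (\<Sum>k\<in>{1..K n}. \<bar>measure (E n \<omega>) (C n k) - q n * measure \<mu> (C n k)\<bar>) < \<epsilon> * (q n * r n)"
      by (intro deviation_small_of_arbitrary_coupling[OF assms(1,2) _ assms(5,6) q(1) r(1) R
            assms(15,16) that] assms(4))
  next
    assume "stochastic_coupling P \<mu> q E" and "(\<lambda>n. sqrt (ln (ln (q n)) / q n)) \<in> o(r)"
      and "\<forall>n. \<forall>k\<in>{1..K (Suc n)}. \<exists>k'\<in>{1..K n}. C (Suc n) k \<subseteq> C n k'"
    then show "AE \<omega> in P. \<forall>\<^sub>F n in sequentially.
        (\<Sum>k\<in>{1..K n}. \<bar>measure (E n \<omega>) (C n k) - q n * measure \<mu> (C n k)\<bar>) < \<epsilon> * (q n * r n)"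
      by (intro deviation_small_of_nested_coupling[OF assms(1,2) _ assms(5,6) q(1) q_inc q(3) r(1) R c
            assms(15,16) that] assms(4))
  qed
  have "AE \<omega> in P. \<forall>\<^sub>F n in sequentially. \<bar>\<Delta> n \<omega> / (q n * r n)\<bar> < \<epsilon>" if "0 < \<epsilon>" for \<epsilon>
  proof -
    have ratio: "\<bar>\<Delta> n \<omega> / (q n * r n)\<bar> < \<epsilon>" if "\<Delta> n \<omega> < \<epsilon> * (q n * r n)" for n \<omega>
    proof -
      have "0 \<le> \<Delta> n \<omega>" unfolding \<Delta>_def by (intro sum_nonneg) simp
      then show ?thesis using that q(1)[of n] r(1)[of n] by (simp add: pos_divide_less_eq)
    qed
    show "AE \<omega> in P. \<forall>\<^sub>F n in sequentially. \<bar>\<Delta> n \<omega> / (q n * r n)\<bar> < \<epsilon>"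
      using small[OF that]
      by eventually_elim (rule eventually_mono, assumption, rule ratio)
  qed
  then have "AE \<omega> in P. (\<lambda>n. \<Delta> n \<omega> / (q n * r n)) \<longlonglongrightarrow> 0"
    by (rule AE_tendsto_zeroI)
  moreover have "1 / r n * (\<Sum>k\<in>{1..K n}. \<bar>1 / q n * measure (E n \<omega>) (C n k) - measure \<mu> (C n k)\<bar>)
      = \<Delta> n \<omega> / (q n * r n)" for n \<omega>
  proof -
    have "\<bar>1 / q n * measure (E n \<omega>) (C n k) - measure \<mu> (C n k)\<bar>
        = \<bar>measure (E n \<omega>) (C n k) - q n * measure \<mu> (C n k)\<bar> / q n" for k
    proof -
      have "1 / q n * measure (E n \<omega>) (C n k) - measure \<mu> (C n k)
          = (measure (E n \<omega>) (C n k) - q n * measure \<mu> (C n k)) / q n"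
        using q(1)[of n] by (simp add: field_simps)
      then show ?thesis using q(1)[of n] by (simp add: abs_divide)
    qed
    then show ?thesis by (simp add: \<Delta>_def sum_divide_distrib[symmetric] mult.commute)
  qed
  ultimately show ?thesis by simp
qed

end
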